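(* Let $(X,d)$ be a compact metric space and let $F:X\to 2^X$ be an upper semicontinuous chain transitive set-valued map. If $F$ has the periodic shadowing property, then $F$ has the shadowing property and is topologically transitive.
   Context: Here $\mathbb N=\{0,1,2,\dots\}$ and $2^X$ is the family of nonempty compact subsets of $X$. For $x\in X$ and $A\subset X$, $d(x,A)=\inf\{d(x,y): y\in A\}$. $F$ is upper semicontinuous if for every $x\in X$ and every open $U\supset F(x)$ there is an open neighborhood $V$ of $x$ with $F(y)\subset U$ for all $y\in V$. An orbit of $F$ is a sequence $\{x_i\}_{i\in\mathbb N}$ with $x_{i+1}\in F(x_i)$ for all $i$. A $\delta$-pseudo-orbit is a sequence $\{x_i\}_{i\in\mathbb N}$ with $d(x_{i+1},F(x_i))<\delta$ for all $i$. A sequence (orbit or pseudo-orbit) $\{x_i\}_{i\in\mathbb N}$ is periodic if there is an integer $m\ge 1$ with $x_{i+m}=x_i$ for all $i\in\mathbb N$. A $\delta$-chain from $x$ to $y$ is a finite sequence $x=x_0,x_1,\dots,x_n=y$, $n\ge 1$, with $d(x_{i+1},F(x_i))<\delta$ for $0\le i\le n-1$. - Shadowing property: for every $\varepsilon>0$ there is $\delta>0$ such that for every $\delta$-pseudo-orbit $\{x_i\}_{i\in\mathbb N}$ there is an orbit $\{z_i\}_{i\in\mathbb N}$ with $d(z_i,x_i)<\varepsilon$ for all $i\in\mathbb N$. - Periodic shadowing property: for every $\varepsilon>0$ there is $\delta>0$ such that for every periodic $\delta$-pseudo-orbit $\{x_i\}_{i\in\mathbb N}$ there is a periodic orbit $\{z_i\}_{i\in\mathbb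 N}$ (not required to have the same period) with $d(z_i,x_i)<\varepsilon$ for all $i\in\mathbb N$. - Topologically transitive: for all nonempty open $U,V\subset X$ there are an orbit $\{x_i\}_{i\in\mathbb N}$ and an integer $n\ge 0$ with $x_0\in U$ and $x_n\in V$. - Chain transitive: for every $\delta>0$ and all $x,y\in X$ there is a $\delta$-chain from $x$ to $y$. *)

theory Defs
  imports "HOL-Analysis.Analysis"
begin

text \<open>
  The space is a subset \<open>X\<close> of a type of class \<open>metric_space\<close> with the induced metric; topological
  notions are relative to \<open>X\<close>. Set-valued maps are total functions of which only the values on \<open>X\<close>
  matter. All values on \<open>X\<close> are nonempty, so \<open>infdist y (F x)\<close> is the distance $d(y, F(x))$
  (the library convention for the empty set is never used).
\<close>

definition compact_hyperspace :: "'a::metric_space set \<Rightarrow> 'a set set" where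
  "compact_hyperspace X = {A. A \<subseteq> X \<and> A \<noteq> {} \<and> compact A}"

definition upper_semicontinuous_on :: "'a::metric_space set \<Rightarrow> ('a \<Rightarrow> 'a set) \<Rightarrow> bool" where
  "upper_semicontinuous_on X F \<longleftrightarrow>
     (\<forall>x\<in>X. \<forall>U. openin (top_of_set X) U \<and> F x \<subseteq> U \<longrightarrow>
        (\<exists>V. openin (top_of_set X) V \<and> x \<in> V \<and> (\<forall>y\<in>V. F y \<subseteq> U)))"

definition orbit_on :: "'a::metric_space set \<Rightarrow> ('a \<Rightarrow> 'a set) \<Rightarrow> (nat \<Rightarrow> 'a) \<Rightarrow> bool" where
  "orbit_on X F x \<longleftrightarrow> (\<forall>i. x i \<in> X) \<and> (\<forall>i. x (Suc i) \<in> F (x i))"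

definition pseudo_orbit_on ::
    "'a::metric_space set \<Rightarrow> ('a \<Rightarrow> 'a set) \<Rightarrow> real \<Rightarrow> (nat \<Rightarrow> 'a) \<Rightarrow> bool" where
  "pseudo_orbit_on X F \<delta> x \<longleftrightarrow> (\<forall>i. x i \<in> X) \<and> (\<forall>i. infdist (x (Suc i)) (F (x i)) < \<delta>)"

definition periodic_seq :: "(nat \<Rightarrow> 'a) \<Rightarrow> bool" where
  "periodic_seq x \<longleftrightarrow> (\<exists>m\<ge>1. \<forall>i. x (i + m) = x i)"

definition has_chain_on ::
    "'a::metric_space set \<Rightarrow> ('a \<Rightarrow> 'a set) \<Rightarrow> real \<Rightarrow> 'a \<Rightarrow> 'a \<Rightarrow> bool" where
  "has_chain_on X F \<delta> x y \<longleftrightarrow>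
     (\<exists>n\<ge>1. \<exists>c :: nat \<Rightarrow> 'a. c 0 = x \<and> c n = y \<and> (\<forall>i\<le>n. c i \<in> X) \<and>
        (\<forall>i<n. infdist (c (Suc i)) (F (c i)) < \<delta>))"

definition shadowing_on :: "'a::metric_space set \<Rightarrow> ('a \<Rightarrow> 'a set) \<Rightarrow> bool" where
  "shadowing_on X F \<longleftrightarrow>
     (\<forall>\<epsilon>>0. \<exists>\<delta>>0. \<forall>x. pseudo_orbit_on X F \<delta> x \<longrightarrow>
        (\<exists>z. orbit_on X F z \<and> (\<forall>i. dist (z i) (x i) < \<epsilon>)))"

definition periodic_shadowing_on :: "'a::metric_space set \<Rightarrow> ('a \<Rightarrow> 'a set) \<Rightarrow> bool" where
  "periodic_shadowing_on X F \<longleftrightarrow>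
     (\<forall>\<epsilon>>0. \<exists>\<delta>>0. \<forall>x. pseudo_orbit_on X F \<delta> x \<and> periodic_seq x \<longrightarrow>
        (\<exists>z. orbit_on X F z \<and> periodic_seq z \<and> (\<forall>i. dist (z i) (x i) < \<epsilon>)))"

definition topologically_transitive_on :: "'a::metric_space set \<Rightarrow> ('a \<Rightarrow> 'a set) \<Rightarrow> bool" where
  "topologically_transitive_on X F \<longleftrightarrow>
     (\<forall>U V. openin (top_of_set X) U \<and> U \<noteq> {} \<and> openin (top_of_set X) V \<and> V \<noteq> {} \<longrightarrow>
        (\<exists>x n. orbit_on X F x \<and> x 0 \<in> U \<and> x n \<in> V))"

definition chain_transitive_on :: "'a::metric_space set \<Rightarrow> ('a \<Rightarrow> 'a set) \<Rightarrow> bool" where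
  "chain_transitive_on X F \<longleftrightarrow> (\<forall>\<delta>>0. \<forall>x\<in>X. \<forall>y\<in>X. has_chain_on X F \<delta> x y)"

end

theory Submission
  imports Defs
begin

text \<open>
  A finite pseudo-orbit closes up, by chain transitivity, to a periodic one, which is shadowed by a
  periodic orbit. Applied to a chain from one open set to another this gives transitivity; applied
  to the initial segments of an infinite pseudo-orbit it gives orbits shadowing longer and longer
  segments, and any limit of these in the compact space of sequences in \<open>X\<close> is an orbit, because
  the graph of \<open>F\<close> is closed.
\<close>

text \<open>If \<open>y\<close> were at distance \<open>e > 0\<close> from \<open>F x\<close>, the
  points of \<open>X\<close> within \<open>e/2\<close> of \<open>F x\<close> would form a relatively
  open set containing \<open>F x\<close>. Upper semicontinuity puts \<open>t n\<close> there
  eventually, so the limit \<open>y\<close> would be within \<open>e/2\<close> of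
  \<open>F x\<close>.\<close>

lemma upper_semicontinuous_closed_graph:
  assumes usc: "upper_semicontinuous_on X F"
    and x: "x \<in> X" and closed: "closed (F x)" and sub: "F x \<subseteq> X" "F x \<noteq> {}"
    and lims: "s \<longlonglongrightarrow> x" "t \<longlonglongrightarrow> y"
    and sX: "\<And>n. s n \<in> X" and st: "\<forall>\<^sub>F n in sequentially. t n \<in> F (s n)"
  shows "y \<in> F x"
proof (rule ccontr)
  assume "y \<notin> F x"
  define e where "e = infdist y (F x)"
  have "e > 0"
    unfolding e_def using \<open>y \<notin> F x\<close> closed sub by (simp add: infdist_pos_not_in_closed)
  define U where "U = X \<inter> (\<lambda>u. infdist u (F x)) -` {..<e/2}"
  have "openin (top_of_set X) U"
    unfolding U_def by (intro continuous_openin_preimage_gen continuous_intros open_lessThan)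
  moreover have "F x \<subseteq> U"
    using sub \<open>e > 0\<close> by (auto simp: U_def)
  ultimately obtain V where V: "openin (top_of_set X) V" "x \<in> V" "\<forall>y\<in>V. F y \<subseteq> U"
    using usc x unfolding upper_semicontinuous_on_def by meson
  obtain W where W: "open W" "V = X \<inter> W"
    using V(1) by (auto simp: openin_open)
  have "\<forall>\<^sub>F n in sequentially. s n \<in> W"
    using lims(1) W V(2) by (auto intro: topological_tendstoD)
  then have "\<forall>\<^sub>F n in sequentially. infdist (t n) (F x) \<le> e/2"
    using st
  proof eventually_elim
    case (elim n)
    then have "t n \<in> U" using V(3) W(2) sX by blast
    then show ?case by (simp add: U_def)
  qed
  moreover have "(\<lambda>n. infdist (t n) (F x)) \<longlonglongrightarrow> e"
    unfolding e_def by (intro tendsto_infdist lims)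
  ultimately have "e \<le> e/2"
    by (intro tendsto_upperbound) auto
  with \<open>e > 0\<close> show False by simp
qed

text \<open>Chain transitivity supplies a return chain \<open>d\<close> from \<open>c n\<close> to
  \<open>c 0\<close>; the closed chain made of \<open>c\<close> followed by \<open>d\<close> is then
  repeated forever.\<close>

lemma chain_extends_to_periodic_pseudo_orbit:
  assumes "chain_transitive_on X F" "\<delta> > 0"
    and cX: "\<And>i. i \<le> n \<Longrightarrow> c i \<in> X"
    and c: "\<And>i. i < n \<Longrightarrow> infdist (c (Suc i)) (F (c i)) < \<delta>"
  shows "\<exists>p. pseudo_orbit_on X F \<delta> p \<and> periodic_seq p \<and> (\<forall>i\<le>n. p i = c i)"
proof -
  have "has_chain_on X F \<delta> (c n) (c 0)"
    using assms(1,2) cX by (simp add: chain_transitive_on_def)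
  then obtain m d where m: "m \<ge> 1" and d: "d 0 = c n" "d m = c 0" "\<And>i. i \<le> m \<Longrightarrow> d i \<in> X"
      "\<And>i. i < m \<Longrightarrow> infdist (d (Suc i)) (F (d i)) < \<delta>"
    unfolding has_chain_on_def by blast
  \<comment> \<open>\<open>c\<close> and \<open>d\<close> overlap at index \<open>n\<close>, where
    \<open>d 0 = c n\<close>. As \<open>m \<ge> 1\<close>, the period \<open>n + m\<close> is
    positive and exceeds every index of \<open>c\<close>, even when \<open>n = 0\<close>.\<close>
  define q where "q j = (if j \<le> n then c j else d (j - n))" for j
  define p where "p i = q (i mod (n + m))" for i
  have qX: "q j \<in> X" if "j < n + m" for j
    using that cX d(3) by (auto simp: q_def)
  have q_step: "infdist (q (Suc j)) (F (q j)) < \<delta>" if "j < n + m" for j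
  proof -
    consider "j < n" | "j = n" | "j > n" by linarith
    then show ?thesis
    proof cases
      case 2
      then show ?thesis using d(1) d(4)[of 0] m by (simp add: q_def)
    next
      case 3
      then show ?thesis using d(4)[of "j - n"] that by (simp add: q_def Suc_diff_le)
    qed (simp add: q_def c)
  qed
  have q_end: "q (n + m) = q 0"
    using m d by (simp add: q_def)
  \<comment> \<open>At the wrap-around \<open>Suc i mod (n + m)\<close> is 0, and
    \<open>q_end\<close> identifies \<open>q 0\<close> with \<open>q (n + m)\<close>, so every step
    of \<open>p\<close> is a step of \<open>q\<close>.\<close>
  have p_Suc: "p (Suc i) = q (Suc (i mod (n + m)))" for i
    using q_end by (simp add: p_def mod_Suc)
  have mod_less: "i mod (n + m) < n + m" for i
    using m by simp
  show ?thesis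
  proof (intro exI[of _ p] conjI allI impI)
    show "pseudo_orbit_on X F \<delta> p"
      unfolding pseudo_orbit_on_def p_Suc
      unfolding p_def using qX[OF mod_less] q_step[OF mod_less] by simp
    show "periodic_seq p"
      unfolding periodic_seq_def p_def using m by (intro exI[of _ "n + m"]) simp
    show "p i = c i" if "i \<le> n" for i
      using that m by (simp add: p_def q_def)
  qed
qed

text \<open>A chain is shadowed along with its periodic extension. What matters is that
  \<open>\<delta>\<close> is chosen before the length \<open>n\<close>, so one
  \<open>\<delta>\<close> serves all initial segments of an infinite pseudo-orbit.\<close>

lemma periodic_shadowing_shadows_chains:
  assumes "chain_transitive_on X F" "periodic_shadowing_on X F" "\<epsilon> > 0"
  shows "\<exists>\<delta>>0. \<forall>n c. (\<forall>i\<le>n. c i \<in> X) \<and> (\<forall>i<n. infdist (c (Suc i)) (F (c i)) < \<delta>) \<longrightarrow>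
    (\<exists>z. orbit_on X F z \<and> (\<forall>i\<le>n. dist (z i) (c i) < \<epsilon>))"
proof -
  obtain \<delta> where "\<delta> > 0" and \<delta>: "\<And>p. \<lbrakk>pseudo_orbit_on X F \<delta> p; periodic_seq p\<rbrakk>
      \<Longrightarrow> \<exists>z. orbit_on X F z \<and> periodic_seq z \<and> (\<forall>i. dist (z i) (p i) < \<epsilon>)"
    using assms(2,3) unfolding periodic_shadowing_on_def by meson
  have "\<exists>z. orbit_on X F z \<and> (\<forall>i\<le>n. dist (z i) (c i) < \<epsilon>)"
    if c: "\<forall>i\<le>n. c i \<in> X" "\<forall>i<n. infdist (c (Suc i)) (F (c i)) < \<delta>" for n c
  proof -
    obtain p where "pseudo_orbit_on X F \<delta> p" "periodic_seq p" "\<forall>i\<le>n. p i = c i"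
      using chain_extends_to_periodic_pseudo_orbit[OF assms(1) \<open>\<delta> > 0\<close>, of n c] c by blast
    then show ?thesis
      using \<delta>[of p] by metis
  qed
  with \<open>\<delta> > 0\<close> show ?thesis by blast
qed

text \<open>Tychonoff's theorem makes the product of copies of \<open>X\<close> compact. A countable
  product of metric spaces is metrizable, so it is also sequentially compact; this replaces a
  diagonal argument and yields one \<open>r\<close> for all coordinates.\<close>

lemma compact_sequences_convergent_subseq:
  fixes z :: "nat \<Rightarrow> nat \<Rightarrow> 'a::metric_space"
  assumes "compact X" "\<And>n i. z n i \<in> X"
  obtains r l where "strict_mono r" "\<And>i. l i \<in> X" "\<And>i. (\<lambda>n. z (r n) i) \<longlonglongrightarrow> l i"
proof -
  have "compactin (product_topology (\<lambda>_. euclidean) UNIV) (PiE UNIV (\<lambda>_::nat. X))"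
    using assms(1) by (simp add: compactin_PiE)
  then have "seq_compact (PiE UNIV (\<lambda>_::nat. X))"
    by (simp add: euclidean_product_topology compact_eq_seq_compact_metric)
  moreover have "\<forall>n. z n \<in> PiE UNIV (\<lambda>_. X)"
    using assms(2) by (simp add: PiE_iff)
  ultimately obtain l r where l: "l \<in> PiE UNIV (\<lambda>_. X)" "(z \<circ> r) \<longlonglongrightarrow> l" and r: "strict_mono r"
    by (rule seq_compactE)
  have "(\<lambda>n. z (r n) i) \<longlonglongrightarrow> l i" for i
  proof -
    have "isCont (\<lambda>f. f i) l"
      by (rule continuous_on_interior[OF continuous_on_product_coordinates]) simp
    from isCont_tendsto_compose[OF this l(2)] show ?thesis by (simp add: comp_def)
  qed
  with r l(1) show thesis
    by (intro that) (auto simp: PiE_iff)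
qed

lemma chain_transitive_periodic_shadowing_imp_shadowing:
  assumes "compact X" "F \<in> X \<rightarrow> compact_hyperspace X" "upper_semicontinuous_on X F"
    and "chain_transitive_on X F" "periodic_shadowing_on X F"
  shows "shadowing_on X F"
  unfolding shadowing_on_def
proof (intro allI impI)
  fix \<epsilon> :: real assume "\<epsilon> > 0"
  \<comment> \<open>Strict bounds become weak ones in the limit, so half of
    \<open>\<epsilon>\<close> is kept in reserve.\<close>
  then have "\<epsilon>/2 > 0" by simp
  from periodic_shadowing_shadows_chains[OF assms(4,5) this] obtain \<delta> where "\<delta> > 0" and \<delta>:
    "\<And>n c. \<lbrakk>\<forall>i\<le>n. c i \<in> X; \<forall>i<n. infdist (c (Suc i)) (F (c i)) < \<delta>\<rbrakk>
      \<Longrightarrow> \<exists>z. orbit_on X F z \<and> (\<forall>i\<le>n. dist (z i) (c i) < \<epsilon>/2)"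
    by blast
  have "\<exists>l. orbit_on X F l \<and> (\<forall>i. dist (l i) (x i) < \<epsilon>)" if x: "pseudo_orbit_on X F \<delta> x" for x
  proof -
    have "\<exists>z. orbit_on X F z \<and> (\<forall>i\<le>n. dist (z i) (x i) < \<epsilon>/2)" for n
      by (rule \<delta>) (use x in \<open>auto simp: pseudo_orbit_on_def\<close>)
    then obtain z where z: "\<And>n. orbit_on X F (z n)"
        "\<And>n i. i \<le> n \<Longrightarrow> dist (z n i) (x i) < \<epsilon>/2"
      by metis
    obtain r l where r: "strict_mono r" and l: "\<And>i. l i \<in> X" "\<And>i. (\<lambda>n. z (r n) i) \<longlonglongrightarrow> l i"
      using compact_sequences_convergent_subseq[OF assms(1), of z] z(1)
      by (auto simp: orbit_on_def)
    \<comment> \<open>The coordinates \<open>i\<close> and \<open>Suc i\<close> converge along the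
      same subsequence, so the closed graph applies to the pairs
      \<open>(z (r n) i, z (r n) (Suc i))\<close>.\<close>
    have "l (Suc i) \<in> F (l i)" for i
    proof (rule upper_semicontinuous_closed_graph[OF assms(3) l(1) _ _ _ l(2) l(2)])
      show "closed (F (l i))" "F (l i) \<subseteq> X" "F (l i) \<noteq> {}"
        using funcset_mem[OF assms(2) l(1)[of i]]
        by (auto simp: compact_hyperspace_def compact_imp_closed)
    qed (use z(1) in \<open>auto simp: orbit_on_def\<close>)
    moreover have "dist (l i) (x i) < \<epsilon>" for i
    proof -
      \<comment> \<open>For \<open>n \<ge> i\<close> also \<open>r n \<ge> i\<close>, so index
        \<open>i\<close> lies in the segment that \<open>z (r n)\<close> shadows.\<close>
      have "\<forall>\<^sub>F n in sequentially. dist (z (r n) i) (x i) \<le> \<epsilon>/2"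
        using eventually_ge_at_top[of i]
      proof eventually_elim
        case (elim n)
        then show ?case using z(2)[of i "r n"] seq_suble[OF r, of n] by simp
      qed
      then have "dist (l i) (x i) \<le> \<epsilon>/2"
        by (intro tendsto_upperbound[OF tendsto_dist[OF l(2) tendsto_const]]) auto
      then show ?thesis using \<open>\<epsilon> > 0\<close> by simp
    qed
    ultimately show ?thesis using l(1) by (auto simp: orbit_on_def)
  qed
  then show "\<exists>\<delta>>0. \<forall>x. pseudo_orbit_on X F \<delta> x \<longrightarrow>
      (\<exists>z. orbit_on X F z \<and> (\<forall>i. dist (z i) (x i) < \<epsilon>))"
    using \<open>\<delta> > 0\<close> by blast
qed

lemma chain_transitive_periodic_shadowing_imp_transitive:
  assumes "chain_transitive_on X F" "periodic_shadowing_on X F"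
  shows "topologically_transitive_on X F"
  unfolding topologically_transitive_on_def
proof (intro allI impI)
  fix U V :: "'a set"
  assume UV: "openin (top_of_set X) U \<and> U \<noteq> {} \<and> openin (top_of_set X) V \<and> V \<noteq> {}"
  then obtain u v where uv: "u \<in> U" "v \<in> V" by blast
  obtain e1 where e1: "e1 > 0" "\<And>y. y \<in> X \<Longrightarrow> dist y u < e1 \<Longrightarrow> y \<in> U"
    using UV uv(1) unfolding openin_euclidean_subtopology_iff by blast
  obtain e2 where e2: "e2 > 0" "\<And>y. y \<in> X \<Longrightarrow> dist y v < e2 \<Longrightarrow> y \<in> V"
    using UV uv(2) unfolding openin_euclidean_subtopology_iff by blast
  \<comment> \<open>At this precision an orbit shadowing a chain from \<open>u\<close> to
    \<open>v\<close> starts in the \<open>e1\<close>-ball about \<open>u\<close> and is in the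
    \<open>e2\<close>-ball about \<open>v\<close> at time \<open>n\<close>.\<close>
  have "min e1 e2 > 0"
    using e1(1) e2(1) by simp
  from periodic_shadowing_shadows_chains[OF assms this] obtain \<delta> where "\<delta> > 0" and \<delta>:
    "\<And>n c. \<lbrakk>\<forall>i\<le>n. c i \<in> X; \<forall>i<n. infdist (c (Suc i)) (F (c i)) < \<delta>\<rbrakk>
      \<Longrightarrow> \<exists>z. orbit_on X F z \<and> (\<forall>i\<le>n. dist (z i) (c i) < min e1 e2)"
    by blast
  have "u \<in> X" "v \<in> X"
    using UV uv openin_imp_subset by blast+
  then have "has_chain_on X F \<delta> u v"
    using assms(1) \<open>\<delta> > 0\<close> by (simp add: chain_transitive_on_def)
  then obtain n c where c: "c 0 = u" "c n = v" "\<And>i. i \<le> n \<Longrightarrow> c i \<in> X"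
      "\<And>i. i < n \<Longrightarrow> infdist (c (Suc i)) (F (c i)) < \<delta>"
    unfolding has_chain_on_def by blast
  obtain z where z: "orbit_on X F z" "\<And>i. i \<le> n \<Longrightarrow> dist (z i) (c i) < min e1 e2"
    using \<delta>[of n c] c(3,4) by blast
  have "z 0 \<in> U" "z n \<in> V"
    using z(1) z(2)[of 0] z(2)[of n] c(1,2) e1(2) e2(2) by (auto simp: orbit_on_def)
  then show "\<exists>x n. orbit_on X F x \<and> x 0 \<in> U \<and> x n \<in> V"
    using z(1) by blast
qed

theorem theorem4p2:
  fixes X :: "'a::metric_space set" and F :: "'a \<Rightarrow> 'a set"
  assumes "compact X"
    and "F \<in> X \<rightarrow> compact_hyperspace X"
    and "upper_semicontinuous_on X F"
    and "chain_transitive_on X F"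
    and "periodic_shadowing_on X F"
  shows "shadowing_on X F \<and> topologically_transitive_on X F"
  using chain_transitive_periodic_shadowing_imp_shadowing[OF assms]
    chain_transitive_periodic_shadowing_imp_transitive[OF assms(4,5)] by blast

end
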